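(* Let $n\ge 1$ be an integer, $N=2^n$, let $\mathbf{x}\in\mathbb{C}^N$ be a normalized vector, and let $s\in\{1,\dots,n\}$. The bidirectional state preparation algorithm (defined in the context) with input vector $\mathbf{x}$ and split parameter $s$ generates a quantum circuit with depth $$O\left(2^{s}+\log_2^2(N)-s^2\right)$$ and width (number of qubits) $$O\left((s+1)\frac{N}{2^{s}}\right),$$ where the constants implied by $O(\cdot)$ are absolute (independent of $n$, $s$ and $\mathbf{x}$).
   Context: **Parameters.** Let $N=2^n$ and let $\mathbf{x}=(|x_0|e^{i\omega_0},\dots,|x_{N-1}|e^{i\omega_{N-1}})$ be a normalized complex vector. For $0\le k\le n$ and $1\le i\le 2^{n-k}$ put $$\Omega_{i,k}=\frac{1}{2^{k-1}}\sum_{l=0}^{2^k-1}\omega_{(i-1)2^k+l},\qquad \eta_{i,k}=\Big(\sum_{l=0}^{2^k-1}|x_{(i-1)2^k+l}|^2\Big)^{1/2}.$$ For $1\le v\le n$ and $1\le j\le 2^{n-v}$ put $$\lambda_{j,v}=\Omega_{2j,v-1}-\Omega_{j,v},\qquad \beta_{j,v}=\eta_{2j,v-1}/\eta_{j,v}\ \ (\text{taken to be } 0 \text{ if } \eta_{j,v}=0),\qquad \alpha_{j,v}=2\arcsin(\beta_{j,v}).$$ **Angle tree.** This is the complete binary tree with nodes $(j,v)$, $1\le v\le n$, $1\le j\le 2^{n-v}$. The root is $(1,n)$, the leaves are at level $v=1$, and for $v\ge 2$ the left and right children of $(j,v)$ are $(2j-1,v-1)$ and $(2j,v-1)$. Node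 $(j,v)$ carries the angles $\alpha_{j,v}$ and $\lambda_{j,v}$. **Gates.** $R_y(\theta)=e^{-i\theta Y/2}$ and $R_z(\theta)=e^{-i\theta Z/2}$. A uniformly controlled rotation with $k$ control qubits and one target qubit, with a list of $2^k$ angles $(\theta_0,\dots,\theta_{2^k-1})$, applies the rotation by $\theta_c$ to the target when the controls are in the computational basis state $|c\rangle$. It is implemented by its standard decomposition into single-qubit rotations and CNOT gates, which has depth $O(2^k)$. CSWAP is the controlled-swap gate on one control qubit and two target qubits; it has a constant-size decomposition into single-qubit gates and CNOTs. **Bidirectional state preparation algorithm with split parameter $s\in\{1,\dots,n\}$.** All qubits start in $|0\rangle$. *Stage 1 (top-down).* For each $j\in\{1,\dots,2^{n-s}\}$ use a fresh register $R(j,s)$ of $s$ qubits, one for each level $s,s-1,\dots,1$ of the subtree rooted at $(j,s)$. On each register apply, for $v=s,s-1,\dots,1$ in this order, a uniformly controlled $R_y$ rotation and then a uniformly controlled $R_z$ rotation. Their target is the level-$v$ qubit of the register, their controls are the $s-v$ qubits of levels $s,\dots,v+1$ of the same register, and their angles are respectively the $2^{s-v}$ values $\alpha_{j',v}$ and the $2^{s-v}$ values $\lambda_{j',v}$, with $(j',v)$ running in order over the level-$v$ nodes of the subtree (for $v=s$ there are no controls). The $2^{n-s}$ registers are processed in parallel. *Stage 2 (bottom-up).* For each node $(j,v)$ with $s+1\le v\le n$ use one fresh qubit $q_{j,v}$ and apply $R_y(\alpha_{j,v})$ and then $R_z(\lambda_{j,v})$ to it. Define recursively the $v$-qubit register $R(j,v)$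 as $q_{j,v}$ (its level-$v$ qubit) followed by $R(2j-1,v-1)$. For $v=s+1,\dots,n$ in this order, and for all $j\in\{1,\dots,2^{n-v}\}$ in parallel, apply $v-1$ CSWAP gates, all controlled by $q_{j,v}$, where for each level $u=v-1,\dots,1$ one gate swaps the level-$u$ qubit of $R(2j-1,v-1)$ with the level-$u$ qubit of $R(2j,v-1)$. The output is the resulting circuit; the output register is $R(1,n)$ and all other qubits are ancillas. **Complexity measures.** The width is the total number of qubits. The depth is the number of time steps of the circuit written with single-qubit gates and CNOT gates, where gates acting on disjoint sets of qubits may be executed in the same time step. *)

theory Defs
  imports "HOL-Analysis.Analysis"
begin

section \<open>Single-qubit matrices\<close>

type_synonym mat2 = "complex^2^2"

definition scale :: "complex \<Rightarrow> mat2 \<Rightarrow> mat2" where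
  "scale z A = (\<chi> i j. z * A $ i $ j)"

definition mat2_exp :: "mat2 \<Rightarrow> mat2" where
  "mat2_exp A = (\<Sum>k. (1 / fact k) *\<^sub>R (((**) A) ^^ k) (mat 1))"

definition pauli_X :: mat2 where "pauli_X = vector [vector [0, 1], vector [1, 0]]"
definition pauli_Y :: mat2 where "pauli_Y = vector [vector [0, - \<i>], vector [\<i>, 0]]"
definition pauli_Z :: mat2 where "pauli_Z = vector [vector [1, 0], vector [0, - 1]]"

definition Ry :: "real \<Rightarrow> mat2" where
  "Ry \<theta> = mat2_exp (scale (- \<i> * of_real \<theta> / 2) pauli_Y)"

definition Rz :: "real \<Rightarrow> mat2" where
  "Rz \<theta> = mat2_exp (scale (- \<i> * of_real \<theta> / 2) pauli_Z)"

definition hadamard :: mat2 where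
  "hadamard = vector [vector [1 / sqrt 2, 1 / sqrt 2], vector [1 / sqrt 2, - 1 / sqrt 2]]"

definition T_gate :: mat2 where
  "T_gate = vector [vector [1, 0], vector [0, cis (pi / 4)]]"

definition T_dagger :: mat2 where
  "T_dagger = vector [vector [1, 0], vector [0, cis (- pi / 4)]]"


section \<open>Circuits of single-qubit and CNOT gates\<close>

datatype 'q gate = Single mat2 'q | CNOT 'q 'q  \<comment> \<open>\<open>CNOT control target\<close>\<close>

fun supp :: "'q gate \<Rightarrow> 'q set" where
  "supp (Single U q) = {q}"
| "supp (CNOT c t) = {c, t}"

text \<open>
  The gate list is in order of application. A register is listed starting with its
  highest level, and the output register is part of \<open>qubits\<close>.
\<close>

datatype 'q circuit = Circuit (qubits: "'q set") (gates: "'q gate list") (output_register: "'q list")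

text \<open>
  A schedule with \<open>d\<close> time steps assigns to the \<open>i\<close>-th gate the time step \<open>\<tau> i\<close>. Gates that
  share a qubit keep their order and so never share a time step; all other gates may run
  simultaneously.
\<close>

definition schedule :: "'q gate list \<Rightarrow> nat \<Rightarrow> (nat \<Rightarrow> nat) \<Rightarrow> bool" where
  "schedule gs d \<tau> \<longleftrightarrow>
     (\<forall>i<length gs. \<tau> i < d) \<and>
     (\<forall>i j. i < j \<and> j < length gs \<and> supp (gs ! i) \<inter> supp (gs ! j) \<noteq> {} \<longrightarrow> \<tau> i < \<tau> j)"

definition depth :: "'q circuit \<Rightarrow> nat" where
  "depth C = (LEAST d. \<exists>\<tau>. schedule (gates C) d \<tau>)"

definition width :: "'q circuit \<Rightarrow> nat" where
  "width C = card (qubits C)"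


section \<open>Uniformly controlled rotations and CSWAP\<close>

text \<open>
  The standard (Gray code) decomposition of a uniformly controlled rotation, with \<open>2 ^ k\<close>
  rotations and, for \<open>k > 0\<close>, \<open>2 ^ k\<close> CNOTs. It comes from the recursion
  \<open>UCR(\<theta>) = UCR(\<theta>\<^sup>+) CNOT UCR(\<theta>\<^sup>-) CNOT\<close> on the first control; running the second half
  backwards makes the two inner final CNOTs cancel, so \<open>ucr_core\<close> omits the final CNOT.
  Controls are listed with the most significant bit first.
\<close>

fun ucr_core :: "(real \<Rightarrow> mat2) \<Rightarrow> 'q list \<Rightarrow> 'q \<Rightarrow> (nat \<Rightarrow> real) \<Rightarrow> 'q gate list" where
  "ucr_core R [] t \<theta> = [Single (R (\<theta> 0)) t]"
| "ucr_core R (c # cs) t \<theta> =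
     ucr_core R cs t (\<lambda>i. (\<theta> i + \<theta> (2 ^ length cs + i)) / 2)
     @ [CNOT c t]
     @ rev (ucr_core R cs t (\<lambda>i. (\<theta> i - \<theta> (2 ^ length cs + i)) / 2))"

definition ucr :: "(real \<Rightarrow> mat2) \<Rightarrow> 'q list \<Rightarrow> 'q \<Rightarrow> (nat \<Rightarrow> real) \<Rightarrow> 'q gate list" where
  "ucr R cs t \<theta> = ucr_core R cs t \<theta> @ (case cs of [] \<Rightarrow> [] | c # _ \<Rightarrow> [CNOT c t])"

definition toffoli :: "'q \<Rightarrow> 'q \<Rightarrow> 'q \<Rightarrow> 'q gate list" where
  "toffoli a b t =
     [Single hadamard t, CNOT b t, Single T_dagger t, CNOT a t, Single T_gate t, CNOT b t,
      Single T_dagger t, CNOT a t, Single T_gate b, Single T_gate t, Single hadamard t,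
      CNOT a b, Single T_gate a, Single T_dagger b, CNOT a b]"

definition cswap :: "'q \<Rightarrow> 'q \<Rightarrow> 'q \<Rightarrow> 'q gate list" where
  "cswap c a b = CNOT b a # toffoli c a b @ [CNOT b a]"


section \<open>Angles\<close>

text \<open>Here \<open>2 powi (int k - 1)\<close> is used since the exponent is \<open>-1\<close> for \<open>k = 0\<close>.\<close>

definition Omega :: "(nat \<Rightarrow> real) \<Rightarrow> nat \<Rightarrow> nat \<Rightarrow> real" where
  "Omega \<omega> i k = 1 / 2 powi (int k - 1) * (\<Sum>l<2 ^ k. \<omega> ((i - 1) * 2 ^ k + l))"

definition eta :: "(nat \<Rightarrow> complex) \<Rightarrow> nat \<Rightarrow> nat \<Rightarrow> real" where
  "eta x i k = sqrt (\<Sum>l<2 ^ k. (cmod (x ((i - 1) * 2 ^ k + l)))\<^sup>2)"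

definition lambda_angle :: "(nat \<Rightarrow> real) \<Rightarrow> nat \<Rightarrow> nat \<Rightarrow> real" where
  "lambda_angle \<omega> j v = Omega \<omega> (2 * j) (v - 1) - Omega \<omega> j v"

definition beta :: "(nat \<Rightarrow> complex) \<Rightarrow> nat \<Rightarrow> nat \<Rightarrow> real" where
  "beta x j v = (if eta x j v = 0 then 0 else eta x (2 * j) (v - 1) / eta x j v)"

definition alpha_angle :: "(nat \<Rightarrow> complex) \<Rightarrow> nat \<Rightarrow> nat \<Rightarrow> real" where
  "alpha_angle x j v = 2 * arcsin (beta x j v)"


section \<open>The bidirectional algorithm\<close>

text \<open>
  \<open>Sub j u\<close> is the level-\<open>u\<close> qubit of the stage 1 register for the subtree rooted at \<open>(j, s)\<close>;
  \<open>Node j v\<close> is the stage 2 qubit \<open>q\<^sub>j\<^sub>,\<^sub>v\<close>.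
\<close>

datatype qubit = Sub nat nat | Node nat nat

text \<open>
  \<open>register s j v\<close> is \<open>R(j, v)\<close>, meaningful for \<open>v \<ge> s\<close>; its \<open>v\<close> qubits are listed from
  level \<open>v\<close> down to level 1.
\<close>

fun register :: "nat \<Rightarrow> nat \<Rightarrow> nat \<Rightarrow> qubit list" where
  "register s j v =
     (if v \<le> s then map (Sub j) (rev [1..<s + 1])
      else Node j v # register s (2 * j - 1) (v - 1))"

declare register.simps [simp del]

text \<open>
  The level-\<open>v\<close> nodes of the subtree rooted at \<open>(j, s)\<close> are \<open>((j - 1) * 2 ^ (s - v) + c + 1, v)\<close>
  for \<open>c < 2 ^ (s - v)\<close>.
\<close>

definition top_down :: "nat \<Rightarrow> (nat \<Rightarrow> complex) \<Rightarrow> (nat \<Rightarrow> real) \<Rightarrow> nat \<Rightarrow> qubit gate list" where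
  "top_down s x \<omega> j =
     concat [let controls = map (Sub j) (rev [v + 1..<s + 1]);
                 node = (\<lambda>c. (j - 1) * 2 ^ (s - v) + c + 1)
             in ucr Ry controls (Sub j v) (\<lambda>c. alpha_angle x (node c) v)
                @ ucr Rz controls (Sub j v) (\<lambda>c. lambda_angle \<omega> (node c) v).
             v \<leftarrow> rev [1..<s + 1]]"

definition stage1 :: "nat \<Rightarrow> nat \<Rightarrow> (nat \<Rightarrow> complex) \<Rightarrow> (nat \<Rightarrow> real) \<Rightarrow> qubit gate list" where
  "stage1 n s x \<omega> = concat [top_down s x \<omega> j. j \<leftarrow> [1..<2 ^ (n - s) + 1]]"

definition stage2_rotations ::
  "nat \<Rightarrow> nat \<Rightarrow> (nat \<Rightarrow> complex) \<Rightarrow> (nat \<Rightarrow> real) \<Rightarrow> qubit gate list" where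
  "stage2_rotations n s x \<omega> =
     concat [[Single (Ry (alpha_angle x j v)) (Node j v),
              Single (Rz (lambda_angle \<omega> j v)) (Node j v)].
             v \<leftarrow> [s + 1..<n + 1], j \<leftarrow> [1..<2 ^ (n - v) + 1]]"

definition stage2_swaps :: "nat \<Rightarrow> nat \<Rightarrow> qubit gate list" where
  "stage2_swaps n s =
     concat [concat (map2 (cswap (Node j v))
               (register s (2 * j - 1) (v - 1)) (register s (2 * j) (v - 1))).
             v \<leftarrow> [s + 1..<n + 1], j \<leftarrow> [1..<2 ^ (n - v) + 1]]"

definition bidirectional ::
  "nat \<Rightarrow> nat \<Rightarrow> (nat \<Rightarrow> complex) \<Rightarrow> (nat \<Rightarrow> real) \<Rightarrow> qubit circuit" where
  "bidirectional n s x \<omega> = Circuit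
     ({Sub j u | j u. j \<in> {1..2 ^ (n - s)} \<and> u \<in> {1..s}} \<union>
      {Node j v | j v. v \<in> {s + 1..n} \<and> j \<in> {1..2 ^ (n - v)}})
     (stage1 n s x \<omega> @ stage2_rotations n s x \<omega> @ stage2_swaps n s)
     (register s 1 n)"


section \<open>Checks: closed forms of the rotations\<close>

lemma pow_scaled_involution:
  fixes P :: mat2
  assumes "P ** P = mat 1"
  shows "(((**) (scale z P)) ^^ k) (mat 1) = scale (z ^ k) (if even k then mat 1 else P)"
proof (induction k)
  case (Suc k)
  have s: "(scale z P) ** (scale w Q) = scale (z * w) (P ** Q)" for w and Q :: mat2
    by (simp add: vec_eq_iff scale_def matrix_matrix_mult_def sum_distrib_left algebra_simps)
  show ?case using Suc assms by (simp add: s)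
qed (simp add: scale_def vec_eq_iff)

lemma mat2_exp_involution:
  fixes P :: mat2
  assumes "P ** P = mat 1"
  shows "mat2_exp (scale z P) = scale ((exp z + exp (- z)) / 2) (mat 1) + scale ((exp z - exp (- z)) / 2) P"
    (is "_ = ?R")
proof -
  let ?f = "\<lambda>k. (1 / fact k) *\<^sub>R (((**) (scale z P)) ^^ k) (mat 1)"
  have e: "(\<lambda>k. w ^ k / fact k) sums exp w" for w :: complex
    using exp_converges[of w] by (simp add: scaleR_conv_of_real field_simps)
  have comp: "(\<lambda>k. ?f k $ i $ j) sums (?R $ i $ j)" for i j :: 2
  proof -
    let ?I = "(mat 1 :: mat2) $ i $ j" and ?P = "P $ i $ j"
    have r: "(r *\<^sub>R A) $ i $ j = of_real r * A $ i $ j" for r and A :: mat2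
      by (simp add: scaleR_conv_of_real[where 'a = complex])
    have f: "?f k $ i $ j = z ^ k / fact k * ((?I + ?P) / 2) + (- z) ^ k / fact k * ((?I - ?P) / 2)" for k
      unfolding pow_scaled_involution[OF assms] r
      by (cases "even k") (auto simp: scale_def field_simps)
    have "(\<lambda>k. ?f k $ i $ j) sums (exp z * ((?I + ?P) / 2) + exp (- z) * ((?I - ?P) / 2))"
      unfolding f by (intro sums_add sums_mult2 e)
    moreover have "exp z * ((?I + ?P) / 2) + exp (- z) * ((?I - ?P) / 2) = ?R $ i $ j"
      by (simp add: scale_def field_simps)
    ultimately show ?thesis by simp
  qed
  have "?f sums ?R"
    unfolding sums_def
    by (intro vec_tendstoI) (use comp in \<open>simp add: sums_def sum_component\<close>)
  then show ?thesis unfolding mat2_exp_def by (rule sums_unique[symmetric])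
qed

lemma Ry_closed_form:
  "Ry \<theta> = vector [vector [of_real (cos (\<theta> / 2)), - of_real (sin (\<theta> / 2))],
                 vector [of_real (sin (\<theta> / 2)), of_real (cos (\<theta> / 2))]]"
proof -
  have i: "pauli_Y ** pauli_Y = mat 1"
    by (simp add: pauli_Y_def vec_eq_iff matrix_matrix_mult_def forall_2 sum_2 mat_def)
  have w: "- \<i> * of_real \<theta> / 2 = \<i> * of_real (- (\<theta> / 2))"
    "- (\<i> * of_real (- (\<theta> / 2))) = \<i> * of_real (\<theta> / 2)"
    by auto
  show ?thesis
    unfolding Ry_def w(1) mat2_exp_involution[OF i] w(2)
    unfolding cis_conv_exp[symmetric]
    by (simp add: scale_def pauli_Y_def vec_eq_iff forall_2 mat_def complex_eq_iff)
qed

lemma Rz_closed_form: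
  "Rz \<theta> = vector [vector [cis (- \<theta> / 2), 0], vector [0, cis (\<theta> / 2)]]"
proof -
  have i: "pauli_Z ** pauli_Z = mat 1"
    by (simp add: pauli_Z_def vec_eq_iff matrix_matrix_mult_def forall_2 sum_2 mat_def)
  have w: "- \<i> * of_real \<theta> / 2 = \<i> * of_real (- (\<theta> / 2))"
    "- (\<i> * of_real (- (\<theta> / 2))) = \<i> * of_real (\<theta> / 2)"
    by auto
  show ?thesis
    unfolding Rz_def w(1) mat2_exp_involution[OF i] w(2)
    unfolding cis_conv_exp[symmetric]
    by (simp add: scale_def pauli_Z_def vec_eq_iff forall_2 mat_def complex_eq_iff)
qed


section \<open>Checks: the two decompositions implement the intended operators\<close>

text \<open>A state assigns an amplitude to each computational basis vector \<open>f :: 'q \<Rightarrow> bool\<close>.\<close>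

type_synonym 'q state = "('q \<Rightarrow> bool) \<Rightarrow> complex"

definition bit_index :: "bool \<Rightarrow> 2" where "bit_index b = (if b then 2 else 1)"

definition apply_single :: "(('q \<Rightarrow> bool) \<Rightarrow> mat2) \<Rightarrow> 'q \<Rightarrow> 'q state \<Rightarrow> 'q state" where
  "apply_single U q \<psi> = (\<lambda>f. \<Sum>b\<in>UNIV. U f $ bit_index (f q) $ bit_index b * \<psi> (f(q := b)))"

fun apply_gate :: "'q gate \<Rightarrow> 'q state \<Rightarrow> 'q state" where
  "apply_gate (Single U q) \<psi> = apply_single (\<lambda>_. U) q \<psi>"
| "apply_gate (CNOT c t) \<psi> = (\<lambda>f. \<psi> (f(t := (f t \<noteq> f c))))"

definition run :: "'q gate list \<Rightarrow> 'q state \<Rightarrow> 'q state" where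
  "run gs = fold apply_gate gs"

fun control_value :: "'q list \<Rightarrow> ('q \<Rightarrow> bool) \<Rightarrow> nat" where
  "control_value [] f = 0"
| "control_value (c # cs) f = of_bool (f c) * 2 ^ length cs + control_value cs f"

definition ucr_op :: "(real \<Rightarrow> mat2) \<Rightarrow> 'q list \<Rightarrow> 'q \<Rightarrow> (nat \<Rightarrow> real) \<Rightarrow> 'q state \<Rightarrow> 'q state" where
  "ucr_op R cs t \<theta> = apply_single (\<lambda>f. R (\<theta> (control_value cs f))) t"

definition cswap_op :: "'q \<Rightarrow> 'q \<Rightarrow> 'q \<Rightarrow> 'q state \<Rightarrow> 'q state" where
  "cswap_op c a b \<psi> = (\<lambda>f. \<psi> (if f c then f(a := f b, b := f a) else f))"

definition rotation_family :: "(real \<Rightarrow> mat2) \<Rightarrow> bool" where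
  "rotation_family R \<longleftrightarrow>
     (\<forall>a b. R a ** R b = R (a + b)) \<and> (\<forall>a. pauli_X ** R a ** pauli_X = R (- a))"

lemma rotation_family_Ry: "rotation_family Ry"
  unfolding rotation_family_def Ry_closed_form pauli_X_def
  by (simp add: vec_eq_iff forall_2 matrix_matrix_mult_def sum_2 cos_add sin_add add_divide_distrib
      algebra_simps)

lemma rotation_family_Rz: "rotation_family Rz"
  unfolding rotation_family_def Rz_closed_form pauli_X_def
  by (simp add: vec_eq_iff forall_2 matrix_matrix_mult_def sum_2 cis_mult add_divide_distrib
      diff_divide_distrib algebra_simps)

lemma apply_single_two:
  "apply_single U q \<psi> f = U f $ bit_index (f q) $ 1 * \<psi> (f(q := False))
     + U f $ bit_index (f q) $ 2 * \<psi> (f(q := True))"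
  by (simp add: apply_single_def UNIV_bool bit_index_def)

lemma control_value_upd [simp]: "t \<notin> set cs \<Longrightarrow> control_value cs (f(t := b)) = control_value cs f"
  by (induction cs) auto

lemma control_value_Cons:
  "control_value (c # cs) f = (if f c then 2 ^ length cs + control_value cs f else control_value cs f)"
  by simp

lemma rotation_family_entries:
  assumes "rotation_family R"
  shows "R (a + b) $ i $ j = R a $ i $ 1 * R b $ 1 $ j + R a $ i $ 2 * R b $ 2 $ j"
    and "R (- a) $ 1 $ 1 = R a $ 2 $ 2" "R (- a) $ 1 $ 2 = R a $ 2 $ 1"
    and "R (- a) $ 2 $ 1 = R a $ 1 $ 2" "R (- a) $ 2 $ 2 = R a $ 1 $ 1"
proof -
  have "R (a + b) = R a ** R b" using assms by (simp add: rotation_family_def)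
  then show "R (a + b) $ i $ j = R a $ i $ 1 * R b $ 1 $ j + R a $ i $ 2 * R b $ 2 $ j"
    by (simp add: matrix_matrix_mult_def sum_2)
  have "R (- a) = pauli_X ** R a ** pauli_X" using assms by (simp add: rotation_family_def)
  then show "R (- a) $ 1 $ 1 = R a $ 2 $ 2" "R (- a) $ 1 $ 2 = R a $ 2 $ 1"
    "R (- a) $ 2 $ 1 = R a $ 1 $ 2" "R (- a) $ 2 $ 2 = R a $ 1 $ 1"
    by (simp_all add: matrix_matrix_mult_def sum_2 pauli_X_def)
qed

lemma ucr_op_step:
  fixes \<theta> :: "nat \<Rightarrow> real"
  assumes R: "rotation_family R" and d: "distinct (t # c # cs)"
  defines "p \<equiv> (\<lambda>i. (\<theta> i + \<theta> (2 ^ length cs + i)) / 2)"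
    and "m \<equiv> (\<lambda>i. (\<theta> i - \<theta> (2 ^ length cs + i)) / 2)"
  shows "ucr_op R cs t m (apply_gate (CNOT c t) (ucr_op R cs t p \<psi>)) =
           apply_gate (CNOT c t) (ucr_op R (c # cs) t \<theta> \<psi>)" (is ?A)
    and "ucr_op R cs t p (apply_gate (CNOT c t) (ucr_op R cs t m \<psi>)) =
           ucr_op R (c # cs) t \<theta> (apply_gate (CNOT c t) \<psi>)" (is ?B)
proof -
  note e = rotation_family_entries[OF R]
  have d': "t \<notin> set cs" "t \<noteq> c" "c \<noteq> t" using d by auto
  show ?A
  proof
    fix f
    define k where "k = control_value cs f"
    have s: "\<theta> k = m k + p k" "\<theta> (2 ^ length cs + k) = p k - m k" "\<theta> (k + 2 ^ length cs) = p k - m k"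
      by (simp_all add: p_def m_def field_simps)
    have d: "R (p k - m k) $ i $ j = R (- m k) $ i $ 1 * R (p k) $ 1 $ j
        + R (- m k) $ i $ 2 * R (p k) $ 2 $ j" for i j
      using e(1)[of "- m k" "p k"] by simp
    have d0: "R (m k + p k) $ i $ j = R (m k) $ i $ 1 * R (p k) $ 1 $ j
        + R (m k) $ i $ 2 * R (p k) $ 2 $ j" for i j
      using e(1)[of "m k" "p k"] by (simp add: add.commute)
    have k: "control_value cs (f(t := b)) = k" for b
      using d' by (simp add: k_def)
    show "ucr_op R cs t m (apply_gate (CNOT c t) (ucr_op R cs t p \<psi>)) f =
           apply_gate (CNOT c t) (ucr_op R (c # cs) t \<theta> \<psi>) f"
      unfolding ucr_op_def control_value_Cons
      using d' by (cases "f c"; cases "f t")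
        (simp_all add: apply_single_two k k_def[symmetric] s d d0 e(2-5) bit_index_def algebra_simps
          del: control_value_upd)
  qed
  show ?B
  proof
    fix f
    define k where "k = control_value cs f"
    have s: "\<theta> k = m k + p k" "\<theta> (2 ^ length cs + k) = p k - m k" "\<theta> (k + 2 ^ length cs) = p k - m k"
      by (simp_all add: p_def m_def field_simps)
    have d: "R (p k - m k) $ i $ j = R (p k) $ i $ 1 * R (- m k) $ 1 $ j
        + R (p k) $ i $ 2 * R (- m k) $ 2 $ j" for i j
      using e(1)[of "p k" "- m k"] by simp
    have d0: "R (m k + p k) $ i $ j = R (p k) $ i $ 1 * R (m k) $ 1 $ j
        + R (p k) $ i $ 2 * R (m k) $ 2 $ j" for i j
      using e(1)[of "p k" "m k"] by (simp add: add.commute)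
    have k: "control_value cs (f(t := b)) = k" for b
      using d' by (simp add: k_def)
    show "ucr_op R cs t p (apply_gate (CNOT c t) (ucr_op R cs t m \<psi>)) f =
           ucr_op R (c # cs) t \<theta> (apply_gate (CNOT c t) \<psi>) f"
      unfolding ucr_op_def control_value_Cons
      using d' by (cases "f c"; cases "f t")
        (simp_all add: apply_single_two k k_def[symmetric] s d d0 e(2-5) bit_index_def algebra_simps
          del: control_value_upd)
  qed
qed

lemma CNOT_involution: "c \<noteq> t \<Longrightarrow> apply_gate (CNOT c t) (apply_gate (CNOT c t) \<psi>) = \<psi>"
  by (auto simp: fun_eq_iff intro!: arg_cong[where f = \<psi>])

lemma CNOT_commute:
  "c \<noteq> t \<Longrightarrow> c' \<noteq> t \<Longrightarrow> apply_gate (CNOT c t) (apply_gate (CNOT c' t) \<psi>) =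
     apply_gate (CNOT c' t) (apply_gate (CNOT c t) \<psi>)"
  by (auto simp: fun_eq_iff intro!: arg_cong[where f = \<psi>])

lemma run_append: "run (gs @ hs) \<psi> = run hs (run gs \<psi>)"
  by (simp add: run_def)

lemma run_ucr_core:
  assumes "rotation_family R" "distinct (t # cs)"
  shows "run (ucr_core R cs t \<theta>) \<psi> = (case cs of [] \<Rightarrow> ucr_op R cs t \<theta> \<psi>
           | c # _ \<Rightarrow> apply_gate (CNOT c t) (ucr_op R cs t \<theta> \<psi>))"
    and "run (rev (ucr_core R cs t \<theta>)) \<psi> = (case cs of [] \<Rightarrow> ucr_op R cs t \<theta> \<psi>
           | c # _ \<Rightarrow> ucr_op R cs t \<theta> (apply_gate (CNOT c t) \<psi>))"
  using assms(2)
proof (induction cs arbitrary: \<theta> \<psi>)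
  case Nil
  case 1 show ?case by (simp add: run_def ucr_op_def)
  case 2 show ?case by (simp add: run_def ucr_op_def)
next
  case (Cons c cs)
  let ?X = "\<lambda>c. apply_gate (CNOT c t)"
  have d: "distinct (t # cs)" "distinct (t # c # cs)" if "distinct (t # c # cs)" using that by auto
  have one: "run [CNOT c t] \<phi> = ?X c \<phi>" for c \<phi> by (simp add: run_def)
  have cancel: "?X c' (?X c (?X c' \<phi>)) = ?X c \<phi>" if "c \<noteq> t" "c' \<noteq> t" for c' \<phi>
    by (metis that CNOT_commute CNOT_involution)
  {
    case (1 \<theta> \<psi>)
    let ?p = "\<lambda>i. (\<theta> i + \<theta> (2 ^ length cs + i)) / 2"
    let ?m = "\<lambda>i. (\<theta> i - \<theta> (2 ^ length cs + i)) / 2"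
    note d = d[OF 1]
    have "run (ucr_core R (c # cs) t \<theta>) \<psi> =
        ucr_op R cs t ?m (?X c (ucr_op R cs t ?p \<psi>))"
      unfolding ucr_core.simps run_append one Cons.IH[OF d(1)]
      using d(2) by (cases cs) (auto simp: cancel simp del: apply_gate.simps)
    then show ?case unfolding ucr_op_step(1)[OF assms(1) d(2)] by simp
  next
    case (2 \<theta> \<psi>)
    let ?p = "\<lambda>i. (\<theta> i + \<theta> (2 ^ length cs + i)) / 2"
    let ?m = "\<lambda>i. (\<theta> i - \<theta> (2 ^ length cs + i)) / 2"
    note d = d[OF 2]
    have "run (rev (ucr_core R (c # cs) t \<theta>)) \<psi> =
        ucr_op R cs t ?p (?X c (ucr_op R cs t ?m \<psi>))"
      unfolding ucr_core.simps rev_append rev_rev_ident rev.simps append_Nil append_assoc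
        run_append one Cons.IH[OF d(1)]
      using d(2) by (cases cs) (auto simp: cancel simp del: apply_gate.simps)
    then show ?case unfolding ucr_op_step(2)[OF assms(1) d(2)] by simp
  }
qed

lemma run_ucr:
  assumes "rotation_family R" "distinct (t # cs)"
  shows "run (ucr R cs t \<theta>) \<psi> = ucr_op R cs t \<theta> \<psi>"
proof (cases cs)
  case Nil
  then show ?thesis by (simp add: ucr_def run_def ucr_op_def)
next
  case (Cons c cs')
  then show ?thesis
    using assms CNOT_involution[of c t]
    by (auto simp: ucr_def run_append run_ucr_core run_def[of "[_]"]
        simp del: apply_gate.simps ucr_core.simps)
qed

lemma apply_single_T:
  "apply_single (\<lambda>_. T_gate) q \<psi> f = (if f q then cis (pi / 4) * \<psi> f else \<psi> f)"
  "apply_single (\<lambda>_. T_dagger) q \<psi> f = (if f q then cis (- (pi / 4)) * \<psi> f else \<psi> f)"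
  by (simp_all add: apply_single_two bit_index_def T_gate_def T_dagger_def fun_upd_idem)

lemma apply_single_hadamard:
  "apply_single (\<lambda>_. hadamard) q \<psi> f =
     (\<psi> (f(q := False)) + (if f q then - 1 else 1) * \<psi> (f(q := True))) / sqrt 2"
  by (simp add: apply_single_two bit_index_def hadamard_def diff_divide_distrib add_divide_distrib)

lemma run_toffoli:
  assumes "distinct [a, b, t]"
  shows "run (toffoli a b t) \<psi> = (\<lambda>f. \<psi> (f(t := (f t \<noteq> (f a \<and> f b)))))"
proof
  fix f :: "'a \<Rightarrow> bool"
  have n: "a \<noteq> b" "b \<noteq> a" "a \<noteq> t" "t \<noteq> a" "b \<noteq> t" "t \<noteq> b" using assms by auto
  have w: "cis (pi / 4) * cis (- (pi / 4)) = 1" "cis (pi / 4) * cis (pi / 4) = \<i>"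
    "cis (- (pi / 4)) * cis (- (pi / 4)) = - \<i>"
    by (simp_all add: cis_mult complex_eq_iff)
  have w': "cis (pi / 4) * (cis (- (pi / 4)) * z) = z" "cis (- (pi / 4)) * (cis (pi / 4) * z) = z"
    "cis (pi / 4) * (cis (pi / 4) * z) = \<i> * z" for z
    by (simp_all add: mult.assoc[symmetric] cis_mult)
  have q: "complex_of_real (sqrt 2) * of_real (sqrt 2) = 2"
    by (simp flip: of_real_mult)
  show "run (toffoli a b t) \<psi> f = \<psi> (f(t := (f t \<noteq> (f a \<and> f b))))"
    using n
    by (cases "f a"; cases "f b"; cases "f t")
       (simp_all add: toffoli_def run_def apply_single_T apply_single_hadamard w w' fun_upd_idem
          add_divide_distrib diff_divide_distrib q algebra_simps)
qed

lemma run_cswap: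
  assumes "distinct [c, a, b]"
  shows "run (cswap c a b) \<psi> = cswap_op c a b \<psi>"
proof
  fix f :: "'a \<Rightarrow> bool"
  have n: "c \<noteq> a" "a \<noteq> c" "a \<noteq> b" "b \<noteq> a" "c \<noteq> b" "b \<noteq> c" using assms by auto
  have "run (cswap c a b) \<psi> f = run [CNOT b a] (run (toffoli c a b) (run [CNOT b a] \<psi>)) f"
    by (simp add: cswap_def run_def)
  also have "\<dots> = cswap_op c a b \<psi> f"
    unfolding run_toffoli[OF assms]
    using n by (auto simp: run_def cswap_op_def fun_eq_iff intro!: arg_cong[where f = \<psi>])
  finally show "run (cswap c a b) \<psi> f = cswap_op c a b \<psi> f" .
qed


section \<open>Checks: the circuit uses exactly the qubits it allocates\<close>

lemma set_register:
  assumes "s \<le> v" "j \<ge> 1"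
  shows "set (register s j v) = {Node ((j - 1) * 2 ^ (v - u) + 1) u | u. u \<in> {s + 1..v}} \<union>
           Sub ((j - 1) * 2 ^ (v - s) + 1) ` {1..s}"
  using assms
proof (induction v arbitrary: j)
  case 0
  then show ?case by (auto simp: register.simps)
next
  case (Suc v)
  show ?case
  proof (cases "Suc v \<le> s")
    case True
    then have "s = Suc v" using Suc by simp
    then show ?thesis using Suc.prems by (auto simp: register.simps)
  next
    case False
    then have sv: "s \<le> v" "2 * j - 1 \<ge> 1" using Suc by auto
    have e: "(2 * j - 1 - 1) * 2 ^ (v - u) = (j - 1) * 2 ^ (Suc v - u)" if "u \<le> v" for u
      using that Suc.prems by (simp add: Suc_diff_le diff_mult_distrib)
    have "set (register s j (Suc v)) = insert (Node j (Suc v)) (set (register s (2 * j - 1) v))"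
      using False by (subst register.simps) simp
    also have "\<dots> = {Node ((j - 1) * 2 ^ (Suc v - u) + 1) u | u. u \<in> {s + 1..Suc v}} \<union>
           Sub ((j - 1) * 2 ^ (Suc v - s) + 1) ` {1..s}"
      unfolding Suc.IH[OF sv] e[OF sv(1)]
    proof -
      have "{Node ((2 * j - 1 - 1) * 2 ^ (v - u) + 1) u | u. u \<in> {s + 1..v}} =
        {Node ((j - 1) * 2 ^ (Suc v - u) + 1) u | u. u \<in> {s + 1..v}}"
        using e by (intro Collect_cong) (metis atLeastAtMost_iff)
      moreover have "{Node ((j - 1) * 2 ^ (Suc v - u) + 1) u | u. u \<in> {s + 1..Suc v}} =
        insert (Node j (Suc v)) {Node ((j - 1) * 2 ^ (Suc v - u) + 1) u | u. u \<in> {s + 1..v}}"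
        using sv Suc.prems by (auto simp: le_Suc_eq)
      ultimately show "insert (Node j (Suc v))
          ({Node ((2 * j - 1 - 1) * 2 ^ (v - u) + 1) u | u. u \<in> {s + 1..v}} \<union>
           Sub ((j - 1) * 2 ^ (Suc v - s) + 1) ` {1..s}) =
        {Node ((j - 1) * 2 ^ (Suc v - u) + 1) u | u. u \<in> {s + 1..Suc v}} \<union>
           Sub ((j - 1) * 2 ^ (Suc v - s) + 1) ` {1..s}"
        by simp
    qed
    finally show ?thesis .
  qed
qed

lemma set_upt_closed: "set [a..<b + 1] = {a..b}"
  by auto

lemma supp_ucr: "(\<Union>g\<in>set (ucr R cs t \<theta>). supp g) = insert t (set cs)"
proof -
  have core: "(\<Union>g\<in>set (ucr_core R cs t \<theta>). supp g) = insert t (set cs)" for \<theta>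
    by (induction cs arbitrary: \<theta>) auto
  show ?thesis
    unfolding ucr_def set_append UN_Un core by (cases cs) auto
qed

lemma supp_cswap: "(\<Union>g\<in>set (cswap c a b). supp g) = {c, a, b}"
  by (auto simp: cswap_def toffoli_def)

lemma supp_top_down:
  "(\<Union>g\<in>set (top_down s x \<omega> j). supp g) = Sub j ` {1..s}"
proof -
  have "(\<Union>g\<in>set (top_down s x \<omega> j). supp g) =
    (\<Union>v\<in>{1..s}. insert (Sub j v) (Sub j ` {v + 1..s}))"
    unfolding top_down_def Let_def set_concat set_map set_rev set_upt_closed UN_UN_flatten
      image_image UN_simps set_append UN_Un supp_ucr
    by simp
  also have "\<dots> = Sub j ` {1..s}" by force
  finally show ?thesis .
qed

lemma subtree_index_le:
  fixes i :: nat
  assumes "i \<le> 2 ^ (n - w)" "i \<ge> 1" "u \<le> w" "w \<le> n"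
  shows "(i - 1) * 2 ^ (w - u) + 1 \<le> 2 ^ (n - u)"
proof -
  have "(i - 1) * 2 ^ (w - u) + 2 ^ (w - u) = i * 2 ^ (w - u)"
    using assms(2) by (cases i) auto
  also have "\<dots> \<le> 2 ^ (n - w) * 2 ^ (w - u)" using assms(1) by simp
  also have "\<dots> = 2 ^ (n - u)" using assms by (simp flip: power_add)
  finally show ?thesis using one_le_power[of "2 :: nat" "w - u"] by linarith
qed

lemma register_subset:
  assumes "s \<le> w" "w \<le> n" "i \<ge> 1" "i \<le> 2 ^ (n - w)"
  shows "set (register s i w) \<subseteq> qubits (bidirectional n s x \<omega>)"
  unfolding set_register[OF assms(1,3)]
  using subtree_index_le[OF assms(4,3) _ assms(2)] assms(1,2)
  by (auto simp: bidirectional_def)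

lemma qubits_bidirectional:
  assumes "s \<in> {1..n}"
  shows "(\<Union>g\<in>set (gates (bidirectional n s x \<omega>)). supp g) = qubits (bidirectional n s x \<omega>)"
    and "set (output_register (bidirectional n s x \<omega>)) \<subseteq> qubits (bidirectional n s x \<omega>)"
proof -
  let ?S = "\<lambda>gs. \<Union>g\<in>set gs. supp g" and ?Q = "qubits (bidirectional n s x \<omega>)"
  have 1: "?S (stage1 n s x \<omega>) = (\<Union>j\<in>{1..2 ^ (n - s)}. Sub j ` {1..s})"
    unfolding stage1_def set_concat set_map set_upt_closed UN_UN_flatten image_image
    by (simp add: supp_top_down)
  have 2: "?S (stage2_rotations n s x \<omega>) = (\<Union>v\<in>{s + 1..n}. (\<lambda>j. Node j v) ` {1..2 ^ (n - v)})"
    unfolding stage2_rotations_def set_concat set_map set_upt_closed UN_UN_flatten image_image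
    by auto
  have Q: "?S (stage1 n s x \<omega>) \<union> ?S (stage2_rotations n s x \<omega>) = ?Q"
    unfolding 1 2 by (auto simp: bidirectional_def)
  have 3: "?S (stage2_swaps n s) \<subseteq> ?Q"
  proof -
    have "supp g \<subseteq> ?Q" if v: "s + 1 \<le> v" "v \<le> n" and j: "1 \<le> j" "j \<le> 2 ^ (n - v)"
      and ab: "(a, b) \<in> set (zip (register s (2 * j - 1) (v - 1)) (register s (2 * j) (v - 1)))"
      and g: "g \<in> set (cswap (Node j v) a b)" for v j a b g
    proof -
      have "2 ^ (n - (v - 1)) = 2 * (2 :: nat) ^ (n - v)" using v by (simp flip: power_Suc add: Suc_diff_le)
      then have b: "2 * j \<le> 2 ^ (n - (v - 1))" "2 * j - 1 \<le> 2 ^ (n - (v - 1))" using j by auto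
      have "a \<in> set (register s (2 * j - 1) (v - 1))" "b \<in> set (register s (2 * j) (v - 1))"
        using ab by (auto dest: set_zip_leftD set_zip_rightD)
      moreover have "set (register s (2 * j - 1) (v - 1)) \<subseteq> ?Q" "set (register s (2 * j) (v - 1)) \<subseteq> ?Q"
        by (rule register_subset; use v j b in simp)+
      ultimately have "a \<in> ?Q" "b \<in> ?Q" by blast+
      moreover have "Node j v \<in> ?Q" using v j by (auto simp: bidirectional_def)
      moreover have "supp g \<subseteq> {Node j v, a, b}" using g supp_cswap[of "Node j v" a b] by blast
      ultimately show ?thesis by blast
    qed
    then show ?thesis
      unfolding stage2_swaps_def set_concat set_map set_upt_closed UN_UN_flatten image_image
      by (intro UN_least) (auto simp: split_beta, blast)
  qed
  show "?S (gates (bidirectional n s x \<omega>)) = ?Q"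
  proof -
    have "gates (bidirectional n s x \<omega>) = stage1 n s x \<omega> @ stage2_rotations n s x \<omega> @ stage2_swaps n s"
      by (simp add: bidirectional_def)
    then show ?thesis using Q 3 by (simp add: Un_assoc[symmetric] Un_absorb2)
  qed
  show "set (output_register (bidirectional n s x \<omega>)) \<subseteq> ?Q"
    using register_subset[of s n n 1 x \<omega>] assms by (simp add: bidirectional_def)
qed

end

(* The registers of stage 1 use pairwise disjoint qubits, so the depth of stage 1 is the number of
   gates on one register, a geometric sum over the levels. The rotations of stage 2 add two time
   steps. The swaps at level v run in parallel over the nodes (j, v), since the registers R(i, v - 1)
   are disjoint for distinct i; the v - 1 gates sharing the control of one node run one after
   another. Hence level v costs O(v), and the sum of 2v - 1 over the levels v = s + 1, ..., n is
   n^2 - s^2. *)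

theory Submission
  imports Defs
begin

section \<open>Composing schedules\<close>

text \<open>\<open>depth\<close> is a minimum, so a single schedule suffices to bound it from above.
  This predicate hides the schedule, so that bounds compose along the structure of the gate list and
  the minimum is never evaluated.\<close>

definition schedulable :: "'q gate list \<Rightarrow> nat \<Rightarrow> bool" where
  "schedulable gs d \<longleftrightarrow> (\<exists>\<tau>. schedule gs d \<tau>)"

definition support :: "'q gate list \<Rightarrow> 'q set" where
  "support gs = (\<Union>g\<in>set gs. supp g)"

lemma support_Nil [simp]: "support [] = {}"
  and support_Cons: "support (g # gs) = supp g \<union> support gs"
  and support_append: "support (gs @ hs) = support gs \<union> support hs"
  and support_concat: "support (concat gss) = (\<Union>gs\<in>set gss. support gs)"
  by (auto simp: support_def)

lemma depth_le: "schedulable (gates C) d \<Longrightarrow> depth C \<le> d"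
  unfolding depth_def schedulable_def by (rule Least_le)

lemma schedulable_mono:
  assumes "schedulable gs d" "d \<le> e"
  shows "schedulable gs e"
proof -
  obtain \<tau> where "schedule gs d \<tau>"
    using assms(1) by (auto simp: schedulable_def)
  then have "schedule gs e \<tau>"
    using assms(2) by (auto simp: schedule_def intro: order_less_le_trans)
  then show ?thesis by (auto simp: schedulable_def)
qed

lemma schedulable_length: "schedulable gs (length gs)"
  unfolding schedulable_def schedule_def by (intro exI[of _ id]) auto

lemma schedulable_append:
  assumes "schedulable gs a" "schedulable hs b"
  shows "schedulable (gs @ hs) (a + b)"
proof -
  obtain \<sigma> \<tau> where st: "schedule gs a \<sigma>" "schedule hs b \<tau>"
    using assms by (auto simp: schedulable_def)
  \<comment> \<open>All of \<open>hs\<close> is delayed by \<open>a\<close>, so pairs of gates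
    across the two lists are ordered whether or not they share a qubit.\<close>
  let ?\<rho> = "\<lambda>i. if i < length gs then \<sigma> i else a + \<tau> (i - length gs)"
  have "?\<rho> i < a + b" if "i < length gs + length hs" for i
    using st that by (auto simp: schedule_def trans_less_add1)
  moreover have "?\<rho> i < ?\<rho> j"
    if "i < j" "j < length gs + length hs" "supp ((gs @ hs) ! i) \<inter> supp ((gs @ hs) ! j) \<noteq> {}" for i j
  proof -
    consider "j < length gs" | "i < length gs" "length gs \<le> j" | "length gs \<le> i"
      by linarith
    then show ?thesis
    proof cases
      case 3
      then have "\<tau> (i - length gs) < \<tau> (j - length gs)"
        using st(2) that by (auto simp: schedule_def nth_append diff_less_mono)
      then show ?thesis using 3 that by simp
    qed (use st that in \<open>auto simp: schedule_def nth_append trans_less_add1\<close>)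
  qed
  ultimately have "schedule (gs @ hs) (a + b) ?\<rho>"
    unfolding schedule_def by auto
  then show ?thesis by (auto simp: schedulable_def)
qed

text \<open>Both schedules start at time 0 and run unchanged. The only new pairs are one gate of
  \<open>gs\<close> with one of \<open>hs\<close>, and disjoint supports free these of any ordering
  constraint.\<close>

lemma schedulable_parallel:
  assumes "schedulable gs d" "schedulable hs d" "support gs \<inter> support hs = {}"
  shows "schedulable (gs @ hs) d"
proof -
  obtain \<sigma> \<tau> where st: "schedule gs d \<sigma>" "schedule hs d \<tau>"
    using assms by (auto simp: schedulable_def)
  have disj: "supp (gs ! i) \<inter> supp (hs ! j) = {}" if "i < length gs" "j < length hs" for i j
    using assms(3) nth_mem[OF that(1)] nth_mem[OF that(2)] by (auto simp: support_def)
  let ?\<rho> = "\<lambda>i. if i < length gs then \<sigma> i else \<tau> (i - length gs)"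
  have "?\<rho> i < d" if "i < length gs + length hs" for i
    using st that by (auto simp: schedule_def)
  moreover have "?\<rho> i < ?\<rho> j"
    if "i < j" "j < length gs + length hs" "supp ((gs @ hs) ! i) \<inter> supp ((gs @ hs) ! j) \<noteq> {}" for i j
  proof -
    consider "j < length gs" | "i < length gs" "length gs \<le> j" | "length gs \<le> i"
      by linarith
    then show ?thesis
    proof cases
      case 2
      then show ?thesis using disj[of i "j - length gs"] that by (auto simp: nth_append)
    next
      case 3
      then have "\<tau> (i - length gs) < \<tau> (j - length gs)"
        using st(2) that by (auto simp: schedule_def nth_append diff_less_mono)
      then show ?thesis using 3 that by simp
    qed (use st that in \<open>auto simp: schedule_def nth_append\<close>)
  qed
  ultimately have "schedule (gs @ hs) d ?\<rho>"
    unfolding schedule_def by auto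
  then show ?thesis by (auto simp: schedulable_def)
qed

lemma schedulable_concat_parallel:
  assumes "\<And>i. i \<in> set is \<Longrightarrow> schedulable (f i) d"
    and "\<And>i k. i \<in> set is \<Longrightarrow> k \<in> set is \<Longrightarrow> i \<noteq> k \<Longrightarrow> support (f i) \<inter> support (f k) = {}"
    and "distinct is"
  shows "schedulable (concat (map f is)) d"
  using assms
proof (induction "is")
  case Nil
  show ?case by (simp add: schedulable_def schedule_def)
next
  case (Cons i "is")
  have "schedulable (concat (map f is)) d"
    using Cons.prems by (intro Cons.IH) auto
  moreover have "support (f i) \<inter> support (concat (map f is)) = {}"
    using Cons.prems(2)[of i] Cons.prems(3) by (force simp: support_concat)
  ultimately show ?case
    using Cons.prems(1)[of i] by (auto intro: schedulable_parallel)
qed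

lemma schedulable_concat:
  assumes "\<And>i. i \<in> set is \<Longrightarrow> schedulable (f i) (d i)"
  shows "schedulable (concat (map f is)) (\<Sum>i\<leftarrow>is. d i)"
  using assms
proof (induction "is")
  case Nil
  show ?case by (simp add: schedulable_def schedule_def)
qed (auto intro: schedulable_append)

text \<open>A comprehension over levels \<open>v\<close> and nodes \<open>j\<close> unfolds to a
  doubly nested \<open>concat\<close>. This regroups it level by level, so that levels and nodes can
  be composed by different rules.\<close>

lemma concat_concat: "concat (concat xsss) = concat (map concat xsss)"
  by (induction xsss) auto


section \<open>The stages of the algorithm\<close>

text \<open>Each control maps the length L to 2L + 1, so L + 1 doubles. Stating the count for L + 1
  avoids subtraction on naturals.\<close>

lemma length_ucr_core: "Suc (length (ucr_core R cs t \<theta>)) = 2 * 2 ^ length cs"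
proof (induction cs arbitrary: \<theta>)
  case (Cons c cs)
  show ?case
    using Cons[of "\<lambda>i. (\<theta> i + \<theta> (2 ^ length cs + i)) / 2"]
      Cons[of "\<lambda>i. (\<theta> i - \<theta> (2 ^ length cs + i)) / 2"] by simp
qed simp

lemma length_ucr: "length (ucr R cs t \<theta>) \<le> 2 * 2 ^ length cs"
  using length_ucr_core[of R cs t \<theta>] by (auto simp: ucr_def split: list.split)

text \<open>A geometric sum after reversing the index. It serves twice: with \<open>s = 0\<close>
  for the gates on one stage 1 register, and in general for the number of stage 2 nodes.\<close>

lemma sum_powers_below: "(\<Sum>v\<in>{s + 1..n}. (2::nat) ^ (n - v)) \<le> 2 ^ (n - s) - 1"
proof -
  have "(\<Sum>v\<in>{s + 1..n}. (2::nat) ^ (n - v)) = (\<Sum>k<n - s. 2 ^ k)"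
    by (rule sum.reindex_bij_witness[of _ "\<lambda>k. n - k" "\<lambda>v. n - v"]) auto
  then show ?thesis by (simp add: mask_eq_sum_exp_nat[symmetric] lessThan_def)
qed

lemma length_top_down: "length (top_down s x \<omega> j) \<le> 4 * 2 ^ s"
proof -
  let ?g = "\<lambda>v. let controls = map (Sub j) (rev [v + 1..<s + 1]);
                 node = (\<lambda>c. (j - 1) * 2 ^ (s - v) + c + 1)
             in ucr Ry controls (Sub j v) (\<lambda>c. alpha_angle x (node c) v)
                @ ucr Rz controls (Sub j v) (\<lambda>c. lambda_angle \<omega> (node c) v)"
  \<comment> \<open>Level \<open>v\<close> has two uniformly controlled rotations, each with
    \<open>s - v\<close> controls.\<close>
  have g: "length (?g v) \<le> 4 * 2 ^ (s - v)" for v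
    unfolding Let_def length_append
    by (rule order_trans[OF add_mono[OF length_ucr length_ucr]]) (simp del: upt_Suc)
  have "length (top_down s x \<omega> j) = (\<Sum>v\<leftarrow>rev [1..<s + 1]. length (?g v))"
    unfolding top_down_def length_concat map_map comp_def ..
  also have "\<dots> \<le> (\<Sum>v\<leftarrow>rev [1..<s + 1]. 4 * 2 ^ (s - v))"
    by (intro sum_list_mono g)
  also have "\<dots> = 4 * (\<Sum>v\<in>{0 + 1..s}. 2 ^ (s - v))"
    by (simp add: sum_list_distinct_conv_sum_set sum_distrib_left atLeastLessThanSuc_atLeastAtMost
        del: upt_Suc)
  also have "\<dots> \<le> 4 * 2 ^ s"
    using sum_powers_below[where s = 0 and n = s] by simp
  finally show ?thesis .
qed

lemma schedulable_stage1: "schedulable (stage1 n s x \<omega>) (4 * 2 ^ s)"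
  unfolding stage1_def
proof (rule schedulable_concat_parallel)
  fix i k :: nat
  assume "i \<noteq> k"
  then show "support (top_down s x \<omega> i) \<inter> support (top_down s x \<omega> k) = {}"
    unfolding support_def supp_top_down by auto
qed (auto intro: schedulable_mono[OF schedulable_length length_top_down])

text \<open>Parallel composition applies over levels as well as over nodes, since every node has its
  own qubit; only the two rotations on one qubit are sequential.\<close>

lemma schedulable_stage2_rotations: "schedulable (stage2_rotations n s x \<omega>) 2"
  unfolding stage2_rotations_def concat_concat map_map comp_def
proof (intro schedulable_concat_parallel)
  fix v j
  show "schedulable [Single (Ry (alpha_angle x j v)) (Node j v),
      Single (Rz (lambda_angle \<omega> j v)) (Node j v)] 2"
    by (rule schedulable_mono[OF schedulable_length]) simp
qed (auto simp: support_concat support_Cons simp del: upt_Suc)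

section \<open>Disjointness of registers and the swaps of stage 2\<close>

lemma length_register: "s \<le> v \<Longrightarrow> length (register s j v) = v"
proof (induction v arbitrary: j)
  case (Suc v)
  show ?case
  proof (cases "Suc v \<le> s")
    case True
    then show ?thesis using Suc.prems by (subst register.simps) (simp del: upt_Suc)
  next
    case False
    then show ?thesis using Suc.IH by (subst register.simps) simp
  qed
qed (simp add: register.simps)

text \<open>At each level \<open>u\<close> the node index is
  \<open>(i - 1) * 2 ^ (v - u) + 1\<close>, and the stage 1 index has the same form with
  \<open>u = s\<close>. For positive \<open>i\<close> this is injective in \<open>i\<close>.\<close>

lemma register_disjoint:
  assumes "s \<le> v" "i \<ge> 1" "k \<ge> 1" "i \<noteq> k"
  shows "set (register s i v) \<inter> set (register s k v) = {}"
  unfolding set_register[OF assms(1,2)] set_register[OF assms(1,3)]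
  using assms by auto

lemma level_swaps_support:
  "support (concat (map2 (cswap c) as bs)) \<subseteq> insert c (set as \<union> set bs)"
  by (auto simp: support_concat support_def[of "cswap _ _ _"] supp_cswap
      dest: set_zip_leftD set_zip_rightD)

lemma Node_notin_register: "s \<le> w \<Longrightarrow> i \<ge> 1 \<Longrightarrow> w < v \<Longrightarrow> Node j v \<notin> set (register s i w)"
  by (auto simp: set_register)

lemma schedulable_stage2_swaps:
  "schedulable (stage2_swaps n s) (\<Sum>v\<leftarrow>[s + 1..<n + 1]. 17 * (v - 1))"
  unfolding stage2_swaps_def concat_concat map_map comp_def
proof (rule schedulable_concat, rule schedulable_concat_parallel)
  fix v j
  assume v: "v \<in> set [s + 1..<n + 1]"
  let ?l = "concat (map2 (cswap (Node j v))
    (register s (2 * j - 1) (v - 1)) (register s (2 * j) (v - 1)))"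
  \<comment> \<open>The 15 gates of \<open>toffoli\<close> and the two enclosing CNOTs.\<close>
  have "length (cswap c a b) = 17" for c a b :: qubit
    by (simp add: cswap_def toffoli_def)
  moreover have "length (register s i (v - 1)) = v - 1" for i
    using v by (intro length_register) auto
  ultimately have "length ?l = 17 * (v - 1)"
    by (simp add: length_concat comp_def split_beta sum_list_triv)
  then show "schedulable ?l (17 * (v - 1))"
    using schedulable_length by metis
next
  fix v i k
  assume v: "v \<in> set [s + 1..<n + 1]" and i: "i \<in> set [1..<2 ^ (n - v) + 1]"
    and k: "k \<in> set [1..<2 ^ (n - v) + 1]" and ik: "i \<noteq> k"
  let ?R = "\<lambda>i. register s i (v - 1)"
  have sv: "s \<le> v - 1" "v - 1 < v" using v by (auto simp del: upt_Suc)
  have ik1: "i \<ge> 1" "k \<ge> 1" using i k by (simp_all del: upt_Suc)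
  then have le: "2 * i - 1 \<ge> 1" "2 * i \<ge> 1" "2 * k - 1 \<ge> 1" "2 * k \<ge> 1" by linarith+
  have ne: "2 * i - 1 \<noteq> 2 * k - 1" "2 * i - 1 \<noteq> 2 * k" "2 * i \<noteq> 2 * k - 1" "2 * i \<noteq> 2 * k"
    using ik1 ik by presburger+
  have notin: "Node m v \<notin> set (?R l)" if "l \<ge> 1" for l m
    using Node_notin_register sv that by blast
  \<comment> \<open>Separating the blocks of two nodes takes four pairs of child registers, four
    checks that a control lies outside the other node's registers, and distinct controls.\<close>
  have *: "insert a (A \<union> B) \<inter> insert b (C \<union> D) = {}"
    if "A \<inter> C = {}" "A \<inter> D = {}" "B \<inter> C = {}" "B \<inter> D = {}"
      "a \<notin> C" "a \<notin> D" "b \<notin> A" "b \<notin> B" "a \<noteq> b" for a b :: qubit and A B C D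
    using that by blast
  have "insert (Node i v) (set (?R (2 * i - 1)) \<union> set (?R (2 * i))) \<inter>
      insert (Node k v) (set (?R (2 * k - 1)) \<union> set (?R (2 * k))) = {}"
    by (intro * register_disjoint sv le ne notin) (use ik in simp)
  then show "support (concat (map2 (cswap (Node i v)) (?R (2 * i - 1)) (?R (2 * i)))) \<inter>
      support (concat (map2 (cswap (Node k v)) (?R (2 * k - 1)) (?R (2 * k)))) = {}"
    using level_swaps_support[of "Node i v" "?R (2 * i - 1)" "?R (2 * i)"]
      level_swaps_support[of "Node k v" "?R (2 * k - 1)" "?R (2 * k)"] by blast
qed simp

section \<open>Total depth and width\<close>

lemma sum_levels:
  assumes "s \<le> n"
  shows "2 * real (\<Sum>v\<leftarrow>[s + 1..<n + 1]. 17 * (v - 1)) \<le> 17 * ((real n)\<^sup>2 - (real s)\<^sup>2)"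
  using assms
proof (induction n rule: dec_induct)
  case (step n)
  \<comment> \<open>The new level adds 34n on the left, while the right grows by 17(2n + 1).\<close>
  then show ?case by (simp add: power2_eq_square algebra_simps)
qed simp

lemma depth_bidirectional:
  assumes "s \<le> n"
  shows "real (depth (bidirectional n s x \<omega>)) \<le> 17 * (2 ^ s + (real n)\<^sup>2 - (real s)\<^sup>2)"
proof -
  let ?W = "\<Sum>v\<leftarrow>[s + 1..<n + 1]. 17 * (v - 1)"
  have "schedulable (gates (bidirectional n s x \<omega>)) (4 * 2 ^ s + (2 + ?W))"
    unfolding bidirectional_def circuit.sel
    by (intro schedulable_append schedulable_stage1 schedulable_stage2_rotations
        schedulable_stage2_swaps)
  from depth_le[OF this]
  have "real (depth (bidirectional n s x \<omega>)) \<le> real (4 * 2 ^ s + (2 + ?W))"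
    by (simp only: of_nat_le_iff)
  also have "\<dots> = 4 * 2 ^ s + 2 + real ?W" by simp
  also have "\<dots> \<le> 17 * (2 ^ s + (real n)\<^sup>2 - (real s)\<^sup>2)"
  proof -
    \<comment> \<open>The first fact allows the factor 17/2 from \<open>sum_levels\<close> to be
      raised to 17. The second absorbs the constant: 4 * 2^s + 2 is at most 6 * 2^s.\<close>
    have "(real s)\<^sup>2 \<le> (real n)\<^sup>2" "(1 :: real) \<le> 2 ^ s" using assms by simp_all
    then show ?thesis using sum_levels[OF assms] by argo
  qed
  finally show ?thesis .
qed

text \<open>The registers of stage 1 hold \<open>s * 2 ^ (n - s)\<close> qubits. The stage 2 nodes,
  summed over all levels, number fewer than \<open>2 ^ (n - s)\<close>, which gives the extra 1 in
  the factor \<open>s + 1\<close>.\<close>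

lemma width_bidirectional: "width (bidirectional n s x \<omega>) \<le> (s + 1) * 2 ^ (n - s)"
proof -
  let ?S = "{Sub j u | j u. j \<in> {1..2 ^ (n - s)} \<and> u \<in> {1..s}}"
  let ?N = "{Node j v | j v. v \<in> {s + 1..n} \<and> j \<in> {1..2 ^ (n - v)}}"
  have "?S = (\<lambda>(j, u). Sub j u) ` ({1..2 ^ (n - s)} \<times> {1..s})" by auto
  then have "card ?S \<le> card ({1..2 ^ (n - s)} \<times> {1..s} :: (nat \<times> nat) set)"
    by (simp only: card_image_le finite_SigmaI finite_atLeastAtMost)
  then have S: "card ?S \<le> s * 2 ^ (n - s)" by (simp add: mult.commute)
  have "?N = (\<Union>v\<in>{s + 1..n}. (\<lambda>j. Node j v) ` {1..2 ^ (n - v)})" by auto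
  then have "card ?N \<le> (\<Sum>v\<in>{s + 1..n}. card ((\<lambda>j. Node j v) ` {1..2 ^ (n - v)}))"
    using card_UN_le[of "{s + 1..n}" "\<lambda>v. (\<lambda>j. Node j v) ` {1..2 ^ (n - v)}"] by simp
  also have "\<dots> \<le> (\<Sum>v\<in>{s + 1..n}. 2 ^ (n - v))"
    by (intro sum_mono order_trans[OF card_image_le]) auto
  also have "\<dots> \<le> 2 ^ (n - s) - 1" by (rule sum_powers_below)
  finally have "card ?N \<le> 2 ^ (n - s)" by simp
  then show ?thesis
    using S card_Un_le[of ?S ?N] by (simp add: width_def bidirectional_def)
qed

theorem theorem1:
  shows "\<exists>A>0::real. \<exists>B>0::real. \<forall>(n::nat) (s::nat) (x :: nat \<Rightarrow> complex) (\<omega> :: nat \<Rightarrow> real).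
           n \<ge> 1 \<and> s \<in> {1..n} \<and>
           (\<Sum>l<2 ^ n. (cmod (x l))\<^sup>2) = 1 \<and>
           (\<forall>l<2 ^ n. x l = of_real (cmod (x l)) * exp (\<i> * of_real (\<omega> l))) \<longrightarrow>
           (let N = 2 ^ n :: nat; C = bidirectional n s x \<omega> in
             real (depth C) \<le> A * (2 ^ s + (log 2 (real N))\<^sup>2 - (real s)\<^sup>2) \<and>
             real (width C) \<le> B * ((real s + 1) * (real N / 2 ^ s)))"
proof (rule exI[of _ 17], intro conjI exI[of _ 1] allI impI)
  \<comment> \<open>The witnesses 17 and 1 are the constants of \<open>depth_bidirectional\<close>
    and \<open>width_bidirectional\<close>; what remains is to rewrite \<open>2 ^ (n - s)\<close> as
    a quotient and \<open>log 2 (2 ^ n)\<close> as \<open>n\<close>.\<close>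
  fix n s :: nat and x :: "nat \<Rightarrow> complex" and \<omega> :: "nat \<Rightarrow> real"
  assume "n \<ge> 1 \<and> s \<in> {1..n} \<and> (\<Sum>l<2 ^ n. (cmod (x l))\<^sup>2) = 1 \<and>
    (\<forall>l<2 ^ n. x l = of_real (cmod (x l)) * exp (\<i> * of_real (\<omega> l)))"
  then have sn: "s \<le> n" by simp
  have "real (width (bidirectional n s x \<omega>)) \<le> real ((s + 1) * 2 ^ (n - s))"
    using width_bidirectional by (simp only: of_nat_le_iff)
  also have "\<dots> = (real s + 1) * (2 ^ n / 2 ^ s)"
    using sn by (simp add: power_diff[of "2 :: real"] add_divide_distrib distrib_right)
  finally show "let N = 2 ^ n :: nat; C = bidirectional n s x \<omega> in
      real (depth C) \<le> 17 * (2 ^ s + (log 2 (real N))\<^sup>2 - (real s)\<^sup>2) \<and>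
      real (width C) \<le> 1 * ((real s + 1) * (real N / 2 ^ s))"
    using depth_bidirectional[OF sn, of x \<omega>] by (simp add: Let_def log_nat_power)
qed simp_all

end
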